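(* For all $z\in\mathbb C$ with $|z|\leqslant1$, $$\sum_{m=0}^{\infty}e_{S,m}z^{m}=\prod_{p} \Bigl(1+\frac{z-1}{p^{2}} \Bigr),$$ $$\sum_{m=0}^{\infty}e_{E,m}z^{m}=\prod_{p} \Bigl(1+\frac{z-1}{p(p+1)} \Bigr),$$ $$\sum_{m=0}^{\infty}e_{O,m}z^{m}=\prod_{p} \Bigl(1+\frac{z-1}{p^{2}(p+1)} \Bigr).$$
   Context: For a positive integer $n$ and $j\geqslant1$, $\omega_j(n)$ is the number of primes $p$ with $p^j\,\|\,n$ (primes dividing $n$ with multiplicity exactly $j$). Put $\omega_S(n)=\sum_{j\geqslant2}\omega_j(n)$, $\omega_E(n)=\sum_{j\geqslant2,\ j\text{ even}}\omega_j(n)$, $\omega_O(n)=\sum_{j\geqslant3,\ j\text{ odd}}\omega_j(n)$. For integers $m\geqslant 0$, $e_{S,m}$, $e_{E,m}$, $e_{O,m}$ are the natural densities of the positive integers $n$ with $\omega_S(n)=m$, $\omega_E(n)=m$, $\omega_O(n)=m$ respectively, e.g. $e_{S,m}=\lim_{x\to\infty}\frac1x\#\{n\leqslant x:\omega_S(n)=m\}$ (these limits exist). $\prod_p$ denotes a product over all primes. By convention $z^0=1$. *)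

theory Defs
  imports "HOL-Analysis.Analysis" "HOL-Computational_Algebra.Primes"
begin

definition omega :: "nat \<Rightarrow> nat \<Rightarrow> nat" where
  "omega j n = card {p. prime p \<and> multiplicity p n = j}"

text \<open>For fixed positive \<open>n\<close> only finitely many terms of the following sums are nonzero (lemma
  \<open>finite_omega_support\<close> below), so each \<open>infsum\<close> on \<^typ>\<open>nat\<close> is an actual finite sum.\<close>

definition omega_S :: "nat \<Rightarrow> nat" where
  "omega_S n = (\<Sum>\<^sub>\<infinity>j\<in>{2..}. omega j n)"

definition omega_E :: "nat \<Rightarrow> nat" where
  "omega_E n = (\<Sum>\<^sub>\<infinity>j\<in>{j. j \<ge> 2 \<and> even j}. omega j n)"

definition omega_O :: "nat \<Rightarrow> nat" where
  "omega_O n = (\<Sum>\<^sub>\<infinity>j\<in>{j. j \<ge> 3 \<and> odd j}. omega j n)"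

lemma finite_omega_support:
  assumes "n > 0"
  shows "finite {j. omega j n \<noteq> 0}"
proof (rule finite_subset)
  show "{j. omega j n \<noteq> 0} \<subseteq> (\<lambda>p. multiplicity p n) ` prime_factors n \<union> {0}"
  proof
    fix j assume "j \<in> {j. omega j n \<noteq> 0}"
    then have "{p. prime p \<and> multiplicity p n = j} \<noteq> {}"
      unfolding omega_def by force
    then obtain p where "prime p" "multiplicity p n = j" by auto
    then show "j \<in> (\<lambda>p. multiplicity p n) ` prime_factors n \<union> {0}"
      by (cases "j = 0") (auto simp: prime_factors_multiplicity)
  qed
qed auto

lemma infsum_omega:
  assumes "n > 0"
  shows "(\<Sum>\<^sub>\<infinity>j\<in>A. omega j n) = (\<Sum>j | j \<in> A \<and> omega j n \<noteq> 0. omega j n)"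
proof -
  have "(\<Sum>\<^sub>\<infinity>j\<in>A. omega j n) = (\<Sum>\<^sub>\<infinity>j\<in>{j. j \<in> A \<and> omega j n \<noteq> 0}. omega j n)"
    by (rule infsum_cong_neutral) auto
  also have "\<dots> = (\<Sum>j | j \<in> A \<and> omega j n \<noteq> 0. omega j n)"
    by (rule infsum_finite) (rule finite_subset[OF _ finite_omega_support[OF assms]], auto)
  finally show ?thesis .
qed

definition has_natural_density :: "nat set \<Rightarrow> real \<Rightarrow> bool" where
  "has_natural_density A d \<longleftrightarrow>
     ((\<lambda>x::real. real (card {n \<in> A. 0 < n \<and> real n \<le> x}) / x) \<longlongrightarrow> d) at_top"

text \<open>Meaningful only for sets that have a natural density.\<close>

definition natural_density :: "nat set \<Rightarrow> real" where
  "natural_density A = (THE d. has_natural_density A d)"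

definition e_S :: "nat \<Rightarrow> real" where
  "e_S m = natural_density {n. n > 0 \<and> omega_S n = m}"

definition e_E :: "nat \<Rightarrow> real" where
  "e_E m = natural_density {n. n > 0 \<and> omega_E n = m}"

definition e_O :: "nat \<Rightarrow> real" where
  "e_O m = natural_density {n. n > 0 \<and> omega_O n = m}"

text \<open>A product over all primes, in increasing order, is the product over all natural numbers of the
  following sequence.\<close>

definition prime_factor_seq :: "(nat \<Rightarrow> complex) \<Rightarrow> nat \<Rightarrow> complex" where
  "prime_factor_seq f n = (if prime n then f n else 1)"

end

theory Submission
  imports Defs
begin

text \<open>
  Write \<open>v p n\<close> for the exponent of \<open>p\<close> in \<open>n\<close>. All three functions have the form \<open>omega_in J\<close>: they count
  the primes \<open>p\<close> with \<open>v p n \<in> J\<close>, where \<open>J\<close> is \<open>{2, 3, 4, \<dots>}\<close>, \<open>{2, 4, 6, \<dots>}\<close> or \<open>{3, 5, 7, \<dots>}\<close>. For a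
  random \<open>n\<close> the events \<open>v p n \<in> J\<close>, for different \<open>p\<close>, are independent with probabilities
  \<open>q p = (1 - 1/p) * (\<Sum>j\<in>J. 1/p^j)\<close>. The number of events that occur should therefore have the
  generating function \<open>\<Prod>p. 1 - q p + q p * z\<close>, and geometric series give \<open>1/p^2\<close>, \<open>1/(p(p+1))\<close> and
  \<open>1/(p^2(p+1))\<close> for \<open>q p\<close>.

  Independence is obtained one prime at a time. If a set \<open>A\<close> does not see the prime \<open>p\<close>, in the sense that
  \<open>p * n \<in> A \<longleftrightarrow> n \<in> A\<close>, and has density \<open>a\<close>, then \<open>{n \<in> A. v p n \<in> J}\<close> has density \<open>q p * a\<close>
  (\<open>has_natural_density_multiplicity\<close>). The sum over the infinitely many exponents in \<open>J\<close> is exchanged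
  with the limit by Tannery's theorem. It follows that the number of primes \<open>p < k\<close> with
  \<open>v p n \<in> J\<close> is distributed like a sum of independent Bernoulli variables, whose probability generating function is a finite product.

  There are then two passages to the limit \<open>k \<longrightarrow> \<infinity>\<close>. For the densities, the count over \<open>p < k\<close> differs
  from the full count only at multiples of some \<open>p^2\<close> with \<open>p \<ge> k\<close>, since all elements of \<open>J\<close> are at
  least 2; the proportion of such \<open>n\<close> up to \<open>x\<close> is at most the tail of \<open>\<Sum>d. 1/d^2\<close>, uniformly in \<open>x\<close>
  (\<open>has_natural_density_uniform_limit\<close>). For the generating functions on the closed unit disc, a
  bound on the coefficients that is summable in \<open>m\<close> and independent of \<open>k\<close> is needed. Evaluating the
  finite product at \<open>z = 2\<close> gives one of the form \<open>C / 2^m\<close> (\<open>poisson_binomial_le\<close>), and Tannery's theorem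
  applies again.
\<close>

section \<open>Counting functions and natural density\<close>

definition count_upto :: "nat set \<Rightarrow> real \<Rightarrow> nat" where
  "count_upto A x = card {n \<in> A. 0 < n \<and> real n \<le> x}"

lemma has_natural_density_count_upto:
  "has_natural_density A d \<longleftrightarrow> ((\<lambda>x. real (count_upto A x) / x) \<longlongrightarrow> d) at_top"
  by (simp add: has_natural_density_def count_upto_def)

lemma finite_upto [simp]: "finite {n \<in> A. 0 < n \<and> real n \<le> x}"
  by (rule finite_subset[of _ "{..nat \<lfloor>x\<rfloor>}"]) (auto simp: le_nat_floor)

lemma count_upto_mono:
  assumes "\<And>n. n \<in> A \<Longrightarrow> n > 0 \<Longrightarrow> n \<in> B"
  shows "count_upto A x \<le> count_upto B x"
  unfolding count_upto_def using assms by (intro card_mono) auto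

lemma count_upto_positive:
  assumes "x \<ge> 0"
  shows "count_upto {n. n > 0} x = nat \<lfloor>x\<rfloor>"
proof -
  have "{n \<in> {n. n > 0}. 0 < n \<and> real n \<le> x} = {1..nat \<lfloor>x\<rfloor>}"
    using assms by (auto simp: le_nat_floor) linarith
  then show ?thesis by (simp add: count_upto_def)
qed

lemma count_upto_le:
  assumes "x \<ge> 0"
  shows "real (count_upto A x) \<le> x"
proof -
  have "count_upto A x \<le> nat \<lfloor>x\<rfloor>"
    using count_upto_mono[of A "{n. n > 0}" x] count_upto_positive[OF assms] by simp
  then show ?thesis using assms by linarith
qed

lemma count_upto_disjoint_Un:
  assumes "A \<inter> B = {}"
  shows "count_upto (A \<union> B) x = count_upto A x + count_upto B x"
proof -
  have "{n \<in> A \<union> B. 0 < n \<and> real n \<le> x} =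
        {n \<in> A. 0 < n \<and> real n \<le> x} \<union> {n \<in> B. 0 < n \<and> real n \<le> x}" by auto
  then show ?thesis unfolding count_upto_def
    using assms by (simp add: card_Un_disjoint disjoint_iff)
qed

lemma count_upto_times:
  assumes "d > 0"
  shows "count_upto ((*) d ` A) x = count_upto A (x / real d)"
proof -
  have "{n \<in> (*) d ` A. 0 < n \<and> real n \<le> x} = (*) d ` {n \<in> A. 0 < n \<and> real n \<le> x / real d}"
    using assms by (auto simp: field_simps)
  then show ?thesis
    unfolding count_upto_def using assms by (simp add: card_image inj_on_def)
qed

lemma count_upto_diff_le:
  assumes "\<And>n. n > 0 \<Longrightarrow> n \<notin> C \<Longrightarrow> n \<in> A \<longleftrightarrow> n \<in> B"
  shows "\<bar>real (count_upto A x) - real (count_upto B x)\<bar> \<le> real (count_upto C x)"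
proof -
  have sub: "count_upto S x \<le> count_upto T x + count_upto C x" if "\<And>n. n > 0 \<Longrightarrow> n \<in> S \<Longrightarrow> n \<in> T \<or> n \<in> C" for S T
  proof -
    have "count_upto S x \<le> count_upto (T \<union> (C - T)) x"
      using that by (intro count_upto_mono) auto
    also have "\<dots> = count_upto T x + count_upto (C - T) x"
      by (intro count_upto_disjoint_Un) auto
    also have "\<dots> \<le> count_upto T x + count_upto C x"
      by (intro add_mono count_upto_mono) auto
    finally show ?thesis .
  qed
  show ?thesis using sub[of A B] sub[of B A] assms by fastforce
qed

lemma has_natural_density_unique:
  assumes "has_natural_density A c" "has_natural_density A d"
  shows "c = d"
  using assms unfolding has_natural_density_def
  by (meson tendsto_unique trivial_limit_at_top_linorder)

lemma natural_density_eqI: "has_natural_density A d \<Longrightarrow> natural_density A = d"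
  unfolding natural_density_def using has_natural_density_unique by blast

lemma has_natural_density_disjoint_Un:
  assumes "has_natural_density A a" "has_natural_density B b" "A \<inter> B = {}"
  shows "has_natural_density (A \<union> B) (a + b)"
  using tendsto_add[OF assms(1,2)[unfolded has_natural_density_count_upto]]
  by (simp add: has_natural_density_count_upto count_upto_disjoint_Un[OF assms(3)] add_divide_distrib)

lemma has_natural_density_Diff:
  assumes "has_natural_density A a" "has_natural_density B b" "B \<subseteq> A"
  shows "has_natural_density (A - B) (a - b)"
proof -
  have "count_upto A x = count_upto (A - B) x + count_upto B x" for x
    using count_upto_disjoint_Un[OF Diff_disjoint[of B A], of x] assms(3) by (simp add: Un_absorb1)
  then have "real (count_upto (A - B) x) / x = real (count_upto A x) / x - real (count_upto B x) / x" for x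
    by (simp add: add_divide_distrib)
  then show ?thesis
    using tendsto_diff[OF assms(1,2)[unfolded has_natural_density_count_upto]]
    by (simp add: has_natural_density_count_upto)
qed

lemma has_natural_density_empty: "has_natural_density {} 0"
  by (simp add: has_natural_density_def)

lemma has_natural_density_positive: "has_natural_density {n. n > 0} 1"
  unfolding has_natural_density_count_upto
proof (rule Lim_transform_eventually)
  show "((\<lambda>x::real. real_of_int \<lfloor>x\<rfloor> / x) \<longlongrightarrow> 1) at_top"
  proof (rule tendsto_sandwich)
    show "((\<lambda>x::real. 1 - 1 / x) \<longlongrightarrow> 1) at_top"
      by (rule tendsto_eq_intros tendsto_divide_0 filterlim_at_top_imp_at_infinity filterlim_ident refl)+ simp
    show "\<forall>\<^sub>F x::real in at_top. 1 - 1 / x \<le> real_of_int \<lfloor>x\<rfloor> / x"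
      using eventually_gt_at_top[of 0]
    proof eventually_elim
      case (elim x)
      have "(x - 1) / x \<le> real_of_int \<lfloor>x\<rfloor> / x"
        using elim by (intro divide_right_mono) linarith+
      then show ?case using elim by (simp add: diff_divide_distrib)
    qed
    show "\<forall>\<^sub>F x::real in at_top. real_of_int \<lfloor>x\<rfloor> / x \<le> 1"
      using eventually_gt_at_top[of 0] by eventually_elim simp
  qed simp
  show "\<forall>\<^sub>F x::real in at_top. real_of_int \<lfloor>x\<rfloor> / x = real (count_upto {n. n > 0} x) / x"
    using eventually_gt_at_top[of 0] by eventually_elim (simp add: count_upto_positive)
qed

lemma has_natural_density_times:
  assumes "has_natural_density A a" "d > 0"
  shows "has_natural_density ((*) d ` A) (a / real d)"
proof -
  have "filterlim (\<lambda>x. 1 / real d * x) at_top at_top"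
    using assms(2) by (intro filterlim_tendsto_pos_mult_at_top[OF tendsto_const] filterlim_ident) simp
  then have "filterlim (\<lambda>x. x / real d) at_top at_top" by simp
  then have "((\<lambda>x. real (count_upto A (x / real d)) / (x / real d)) \<longlongrightarrow> a) at_top"
    using assms(1) unfolding has_natural_density_count_upto by (rule filterlim_compose[rotated])
  then have "((\<lambda>x. real (count_upto A (x / real d)) / (x / real d) / real d) \<longlongrightarrow> a / real d) at_top"
    using assms(2) by (intro tendsto_divide tendsto_const) auto
  then show ?thesis
    using assms(2) by (simp add: has_natural_density_count_upto count_upto_times)
qed

text \<open>
  Densities alone do not pass to limits of sets: the approximation must be uniform in \<open>x\<close>. Under that
  hypothesis the densities form a Cauchy sequence, and the limits in \<open>k\<close> and \<open>x\<close> may be exchanged.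
\<close>

lemma has_natural_density_uniform_limit:
  assumes dens: "\<And>k. has_natural_density (A k) (D k)"
    and close: "\<And>k x. x > 0 \<Longrightarrow> \<bar>real (count_upto (A k) x) - real (count_upto B x)\<bar> \<le> x * \<epsilon> k"
    and eps: "\<epsilon> \<longlonglongrightarrow> 0"
  obtains d where "D \<longlonglongrightarrow> d" "has_natural_density B d"
proof -
  have close': "\<bar>real (count_upto (A k) x) / x - real (count_upto B x) / x\<bar> \<le> \<epsilon> k" if "x > 0" for k x
    using close[OF that, of k] that
    by (simp add: abs_divide field_simps flip: diff_divide_distrib)
  have D: "\<bar>D k - D l\<bar> \<le> \<epsilon> k + \<epsilon> l" for k l
  proof (rule tendsto_upperbound)
    show "((\<lambda>x. \<bar>real (count_upto (A k) x) / x - real (count_upto (A l) x) / x\<bar>) \<longlongrightarrow> \<bar>D k - D l\<bar>) at_top"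
      using dens unfolding has_natural_density_count_upto by (intro tendsto_intros) auto
    show "\<forall>\<^sub>F x in at_top. \<bar>real (count_upto (A k) x) / x - real (count_upto (A l) x) / x\<bar> \<le> \<epsilon> k + \<epsilon> l"
      using eventually_gt_at_top[of 0]
    proof eventually_elim
      case (elim x)
      show ?case using close'[OF elim, of k] close'[OF elim, of l] by linarith
    qed
  qed simp
  have "Cauchy D"
  proof (rule CauchyI)
    fix e :: real assume "e > 0"
    then have "\<forall>\<^sub>F k in sequentially. \<epsilon> k < e / 2"
      using eps by (intro order_tendstoD(2)[of \<epsilon> 0]) auto
    then obtain N where "\<And>k. k \<ge> N \<Longrightarrow> \<epsilon> k < e / 2"
      by (auto simp: eventually_sequentially)
    then show "\<exists>M. \<forall>m\<ge>M. \<forall>n\<ge>M. norm (D m - D n) < e"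
      using D by (intro exI[of _ N] allI impI) (smt (verit) field_sum_of_halves real_norm_def)
  qed
  then obtain d where d: "D \<longlonglongrightarrow> d"
    using Cauchy_convergent convergent_def by blast
  have unif: "uniform_limit {0<..} (\<lambda>k x. real (count_upto (A k) x) / x) (\<lambda>x. real (count_upto B x) / x) sequentially"
  proof (rule uniform_limitI)
    fix e :: real assume "e > 0"
    then have "\<forall>\<^sub>F k in sequentially. \<epsilon> k < e"
      using eps by (intro order_tendstoD(2)[of \<epsilon> 0]) auto
    then show "\<forall>\<^sub>F k in sequentially. \<forall>x\<in>{0<..}.
                 dist (real (count_upto (A k) x) / x) (real (count_upto B x) / x) < e"
    proof eventually_elim
      case (elim k)
      show ?case
      proof
        fix x :: real assume "x \<in> {0<..}"
        then show "dist (real (count_upto (A k) x) / x) (real (count_upto B x) / x) < e"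
          using close'[of x k] elim by (simp add: dist_real_def)
      qed
    qed
  qed
  have pointwise: "\<forall>\<^sub>F k in sequentially. ((\<lambda>x. real (count_upto (A k) x) / x) \<longlongrightarrow> D k) at_top"
    using dens by (simp add: has_natural_density_count_upto)
  have "\<forall>\<^sub>F x::real in at_top. x \<in> {0<..}"
    by (simp add: eventually_gt_at_top)
  from swap_uniform_limit'[OF pointwise d unif this trivial_limit_sequentially]
  have "((\<lambda>x. real (count_upto B x) / x) \<longlongrightarrow> d) at_top" .
  then show ?thesis using that d by (simp add: has_natural_density_count_upto)
qed

section \<open>The density of a condition on the exponent of one prime\<close>

text \<open>
  The numbers divisible by \<open>p^j\<close> but not by \<open>p^(j+1)\<close> have density \<open>1/p^j - 1/p^(j+1)\<close>.
\<close>

definition valuation_density :: "nat \<Rightarrow> nat set \<Rightarrow> real" where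
  "valuation_density p J = (\<Sum>j. if j \<in> J then (1 - 1 / real p) / real p ^ j else 0)"

lemma valuation_density_sums:
  assumes "p > 1"
  shows "(\<lambda>j. if j \<in> J then (1 - 1 / real p) / real p ^ j else 0) sums valuation_density p J"
  unfolding valuation_density_def
proof (rule summable_sums, rule summable_comparison_test)
  show "\<exists>N. \<forall>n\<ge>N. norm (if n \<in> J then (1 - 1 / real p) / real p ^ n else 0) \<le> (1 / real p) ^ n"
    using assms by (auto simp: power_one_over field_simps)
  show "summable (\<lambda>j. (1 / real p) ^ j)"
    using assms by (intro summable_geometric) simp
qed

text \<open>
  Each \<open>n\<close> is uniquely \<open>p^j * y\<close> with \<open>p\<close> not dividing \<open>y\<close>, and the invariance of \<open>A\<close> allows \<open>y\<close> to be tested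
  for membership instead of \<open>n\<close>.
\<close>

lemma count_upto_multiplicity:
  assumes p: "prime p" and inv: "\<And>n. n > 0 \<Longrightarrow> p * n \<in> A \<longleftrightarrow> n \<in> A" and x: "x > 0"
  shows "(\<lambda>j. if j \<in> J then real (count_upto {n \<in> A. \<not> p dvd n} (x / real p ^ j)) else 0)
           sums real (count_upto {n \<in> A. multiplicity p n \<in> J} x)"
proof -
  define A' where "A' = {n \<in> A. \<not> p dvd n}"
  \<comment> \<open>Only exponents \<open>j \<le> x\<close> matter, because \<open>j < p ^ j \<le> n \<le> x\<close>.\<close>
  define N where "N = Suc (nat \<lfloor>x\<rfloor>)"
  have p1: "p > 1" using p prime_gt_1_nat by blast
  have inv_pow: "p ^ j * n \<in> A \<longleftrightarrow> n \<in> A" if "n > 0" for j n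
  proof (induction j)
    case (Suc j)
    then show ?case using inv[of "p ^ j * n"] p1 that by (simp add: mult.assoc)
  qed simp
  have mult: "multiplicity p (p ^ j * y) = j" if "\<not> p dvd y" for j y
    using p p1 that by (intro multiplicity_eqI) auto
  have small: "j < N" if "0 < p ^ j * y" "real (p ^ j * y) \<le> x" for j y
  proof -
    have "j < p ^ j" using power_gt_expt[of p j] p1 by simp
    also have "p ^ j \<le> p ^ j * y" using that(1) by simp
    finally have "real j < x" using that(2) by linarith
    then show ?thesis unfolding N_def by linarith
  qed
  have decomp: "{n \<in> {n \<in> A. multiplicity p n \<in> J}. 0 < n \<and> real n \<le> x} =
        (\<Union>j\<in>J \<inter> {..<N}. {n \<in> (*) (p ^ j) ` A'. 0 < n \<and> real n \<le> x})" (is "?L = ?R")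
  proof (intro subset_antisym subsetI)
    fix n assume n: "n \<in> ?L"
    obtain y where y: "n = p ^ multiplicity p n * y" "\<not> p dvd y"
      using multiplicity_decompose'[of n p] n p1 by auto
    have "y \<in> A'"
      unfolding A'_def using y n inv_pow[of y "multiplicity p n"] by (cases "y = 0") auto
    moreover have "multiplicity p n < N" using small[of "multiplicity p n" y] y(1) n by auto
    ultimately show "n \<in> ?R" using n y(1) by auto
  next
    fix n assume "n \<in> ?R"
    then obtain j y where "j \<in> J" "n = p ^ j * y" "y \<in> A'" "0 < n" "real n \<le> x" by auto
    then show "n \<in> ?L" using inv_pow[of y j] mult[of y j] unfolding A'_def by auto
  qed
  have "count_upto {n \<in> A. multiplicity p n \<in> J} x = (\<Sum>j\<in>J \<inter> {..<N}. count_upto ((*) (p ^ j) ` A') x)"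
    unfolding count_upto_def decomp
  proof (rule card_UN_disjoint)
    show "\<forall>i\<in>J \<inter> {..<N}. \<forall>j\<in>J \<inter> {..<N}. i \<noteq> j \<longrightarrow>
        {n \<in> (*) (p ^ i) ` A'. 0 < n \<and> real n \<le> x} \<inter> {n \<in> (*) (p ^ j) ` A'. 0 < n \<and> real n \<le> x} = {}"
      using mult unfolding A'_def by (auto; metis)
  qed auto
  also have "\<dots> = (\<Sum>j\<in>J \<inter> {..<N}. count_upto A' (x / real p ^ j))"
    using p1 by (simp add: count_upto_times)
  also have "real \<dots> = (\<Sum>j<N. if j \<in> J then real (count_upto A' (x / real p ^ j)) else 0)"
    by (simp add: sum.If_cases Int_commute)
  finally have count: "real (count_upto {n \<in> A. multiplicity p n \<in> J} x) =
    (\<Sum>j<N. if j \<in> J then real (count_upto A' (x / real p ^ j)) else 0)" .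
  have "(if j \<in> J then real (count_upto A' (x / real p ^ j)) else 0) = 0" if "j \<notin> {..<N}" for j
  proof -
    have "{n \<in> A'. 0 < n \<and> real n \<le> x / real p ^ j} = {}"
      using small[of j] p1 that by (auto simp: field_simps)
    then show ?thesis by (simp add: count_upto_def)
  qed
  then show ?thesis
    unfolding count A'_def by (intro sums_finite) (auto simp: A'_def)
qed

text \<open>
  The independence step. The elements of \<open>A\<close> prime to \<open>p\<close> are those left after removing \<open>p * A\<close>, so they
  have density \<open>(1 - 1/p) * a\<close>. The class of exponent \<open>j\<close> is this set scaled by \<open>p^j\<close>, and its count up to \<open>x\<close>
  is at most \<open>x / p^j\<close>, which is the dominating series for Tannery's theorem.
\<close>

lemma has_natural_density_multiplicity:
  assumes p: "prime p" and inv: "\<And>n. n > 0 \<Longrightarrow> p * n \<in> A \<longleftrightarrow> n \<in> A"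
    and A: "has_natural_density A a"
  shows "has_natural_density {n \<in> A. multiplicity p n \<in> J} (valuation_density p J * a)"
proof -
  define A' where "A' = {n \<in> A. \<not> p dvd n}"
  define f where "f j x = (if j \<in> J then real (count_upto A' (x / real p ^ j)) / x else 0)" for j x
  define g where "g j = (if j \<in> J then (1 - 1 / real p) * a / real p ^ j else 0)" for j
  have p1: "p > 1" using p prime_gt_1_nat by blast
  have A_pos: "has_natural_density {n \<in> A. n > 0} a"
    using A unfolding has_natural_density_def by (simp add: conj_ac)
  have "has_natural_density ({n \<in> A. n > 0} - (*) p ` {n \<in> A. n > 0}) (a - a / real p)"
    using p1 inv by (intro has_natural_density_Diff has_natural_density_times A_pos) auto
  also have "{n \<in> A. n > 0} - (*) p ` {n \<in> A. n > 0} = A'"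
    unfolding A'_def using p1 inv by (auto elim!: dvdE intro!: Nat.gr0I)
  finally have A': "has_natural_density A' (a - a / real p)" .
  have "((\<lambda>x. \<Sum>j. f j x) \<longlongrightarrow> (\<Sum>j. g j)) at_top"
  proof (rule tannerys_theorem[THEN conjunct2, THEN conjunct2])
    have "((\<lambda>x. real (count_upto A' (x / real p ^ j)) / x) \<longlongrightarrow> (a - a / real p) / real p ^ j) at_top" for j
      using has_natural_density_times[OF A', of "p ^ j"] p1
      by (simp add: has_natural_density_count_upto count_upto_times)
    moreover have "(1 - 1 / real p) * a = a - a / real p" by (simp add: algebra_simps)
    ultimately show "((\<lambda>x. f j x) \<longlongrightarrow> g j) at_top" for j
      by (simp add: f_def g_def)
    have "norm (f j x) \<le> (1 / real p) ^ j" if "x > 0" for j x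
      using count_upto_le[of "x / real p ^ j" A'] that p1
      by (simp add: f_def field_simps power_one_over)
    moreover have "\<forall>\<^sub>F jx in sequentially \<times>\<^sub>F at_top. 0 < (snd jx :: real)"
      
      using eventually_prod2[OF trivial_limit_sequentially, of "\<lambda>x::real. 0 < x" at_top]
      by (simp add: case_prod_unfold eventually_gt_at_top)
    ultimately show "\<forall>\<^sub>F (j, x) in at_top \<times>\<^sub>F at_top. norm (f j x) \<le> (1 / real p) ^ j"
      by (auto elim!: eventually_mono simp: case_prod_unfold)
    show "summable (\<lambda>j. (1 / real p) ^ j)"
      using p1 by (intro summable_geometric) simp
  qed simp
  moreover have "(\<Sum>j. g j) = valuation_density p J * a"
    using sums_mult2[OF valuation_density_sums[OF p1, of J], of a]
    by (simp add: g_def if_distrib[of "\<lambda>t. t * a"] sums_iff cong: if_cong)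
  moreover have "(\<Sum>j. f j x) = real (count_upto {n \<in> A. multiplicity p n \<in> J} x) / x" if "x > 0" for x
    using sums_divide[OF count_upto_multiplicity[OF p inv that, where J=J], of x]
    by (simp add: f_def A'_def if_distrib[of "\<lambda>t. t / x"] sums_iff cong: if_cong)
  ultimately show ?thesis
    unfolding has_natural_density_count_upto
    by (auto intro: Lim_transform_eventually eventually_mono[OF eventually_gt_at_top[of 0]])
qed

lemma valuation_density_progression:
  assumes "p > 1" "b > 0"
  shows "valuation_density p (range (\<lambda>i. a + b * i)) = (1 - 1 / real p) / (real p ^ a * (1 - 1 / real p ^ b))"
proof -
  let ?J = "range (\<lambda>i. a + b * i)"
  have "(\<lambda>i. (1 / real p ^ b) ^ i) sums (1 / (1 - 1 / real p ^ b))"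
    using assms by (intro geometric_sums) (simp add: one_less_power)
  from sums_mult[OF this, of "(1 - 1 / real p) / real p ^ a"]
  have "(\<lambda>i. (1 - 1 / real p) / real p ^ (a + b * i)) sums
          ((1 - 1 / real p) / (real p ^ a * (1 - 1 / real p ^ b)))"
    by (simp add: power_add power_mult power_one_over)
  moreover have "strict_mono (\<lambda>i. a + b * i)"
    using assms(2) by (auto intro: strict_monoI)
  ultimately have "(\<lambda>j. if j \<in> ?J then (1 - 1 / real p) / real p ^ j else 0) sums
          ((1 - 1 / real p) / (real p ^ a * (1 - 1 / real p ^ b)))"
    by (subst sums_mono_reindex[symmetric]) (auto simp: rangeI[of "\<lambda>i. a + b * i"])
  then show ?thesis
    using valuation_density_sums[OF assms(1)] sums_unique2 by blast
qed

lemma valuation_density_nonneg: "p > 1 \<Longrightarrow> valuation_density p J \<ge> 0"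
  by (rule sums_le[OF _ sums_zero valuation_density_sums]) auto

lemma valuation_density_le:
  assumes "p > 1" "J \<subseteq> {2..}"
  shows "valuation_density p J \<le> 1 / real p ^ 2"
proof -
  have "valuation_density p J \<le> valuation_density p (range (\<lambda>i. 2 + 1 * i))"
  proof (rule sums_le[OF _ valuation_density_sums valuation_density_sums])
    fix j
    have "j \<in> range (\<lambda>i. 2 + 1 * i)" if "j \<in> J"
      using that assms(2) by (intro image_eqI[of _ _ "j - 2"]) auto
    then show "(if j \<in> J then (1 - 1 / real p) / real p ^ j else 0)
               \<le> (if j \<in> range (\<lambda>i. 2 + 1 * i) then (1 - 1 / real p) / real p ^ j else 0)"
      using assms(1) by auto
  qed (use assms in auto)
  also have "\<dots> = 1 / real p ^ 2"
    unfolding valuation_density_progression[OF assms(1) zero_less_one]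
    using assms(1) by simp
  finally show ?thesis .
qed

section \<open>Sums of independent Bernoulli variables\<close>

text \<open>
  \<open>poisson_binomial q k m\<close> is the probability that exactly \<open>m\<close> of \<open>k\<close> independent events with
  probabilities \<open>q 0, \<dots>, q (k - 1)\<close> occur. The recursion is the form in which the densities
  of arithmetic sets arise when primes are added one at a time.
\<close>

primrec poisson_binomial :: "(nat \<Rightarrow> real) \<Rightarrow> nat \<Rightarrow> nat \<Rightarrow> real" where
  "poisson_binomial q 0 m = (if m = 0 then 1 else 0)"
| "poisson_binomial q (Suc k) m =
     (1 - q k) * poisson_binomial q k m + q k * (case m of 0 \<Rightarrow> 0 | Suc l \<Rightarrow> poisson_binomial q k l)"

lemma poisson_binomial_nonneg:
  assumes "\<And>i. 0 \<le> q i" "\<And>i. q i \<le> 1"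
  shows "poisson_binomial q k m \<ge> 0"
  using assms by (induction k arbitrary: m) (auto split: nat.split intro!: add_nonneg_nonneg mult_nonneg_nonneg)

lemma poisson_binomial_sums:
  fixes z :: complex
  shows "(\<lambda>m. of_real (poisson_binomial q k m) * z ^ m) sums (\<Prod>i<k. 1 + (z - 1) * of_real (q i))"
proof (induction k)
  case 0
  have "(\<lambda>m. of_real (poisson_binomial q 0 m) * z ^ m) sums (\<Sum>m\<in>{0}. of_real (poisson_binomial q 0 m) * z ^ m)"
    by (rule sums_finite) auto
  then show ?case by simp
next
  case (Suc k)
  let ?P = "\<Prod>i<k. 1 + (z - 1) * of_real (q i)"
  let ?shift = "\<lambda>m. of_real (case m of 0 \<Rightarrow> 0 | Suc l \<Rightarrow> poisson_binomial q k l) * z ^ m"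
  have "?shift sums (z * ?P)"
    using sums_mult[OF Suc.IH, of z] by (subst sums_Suc_imp) (simp_all add: mult_ac)
  from sums_add[OF sums_mult[OF Suc.IH, of "1 - of_real (q k)"] sums_mult[OF this, of "of_real (q k)"]]
  show ?case by (simp add: algebra_simps)
qed

text \<open>
  At \<open>z = 2\<close> the generating function is \<open>\<Prod>i<k. 1 + q i\<close>, which is bounded independently of \<open>k\<close>, and each
  single term of the series is at most the whole sum. This excludes escape of mass to infinity.
\<close>

lemma poisson_binomial_le:
  assumes q: "\<And>i. 0 \<le> q i" "\<And>i. q i \<le> 1" "summable q"
  shows "poisson_binomial q k m \<le> exp (suminf q) * (1 / 2) ^ m"
proof -
  have "(\<lambda>m. of_real (poisson_binomial q k m * 2 ^ m)) sums (of_real (\<Prod>i<k. 1 + q i) :: complex)"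
    using poisson_binomial_sums[of q k 2] by simp
  then have *: "(\<lambda>m. poisson_binomial q k m * 2 ^ m) sums (\<Prod>i<k. 1 + q i)"
    by (rule sums_of_real_iff[THEN iffD1])
  have "(\<Sum>i\<in>{m}. poisson_binomial q k i * 2 ^ i) \<le> (\<Prod>i<k. 1 + q i)"
    unfolding sums_unique[OF *]
    by (rule sum_le_suminf) (use sums_summable[OF *] poisson_binomial_nonneg[OF q(1,2)] in auto)
  also have "\<dots> \<le> (\<Prod>i<k. exp (q i))"
    using q(1) by (intro prod_mono) (simp add: add_nonneg_nonneg)
  also have "\<dots> = exp (\<Sum>i<k. q i)" by (simp add: exp_sum)
  also have "\<dots> \<le> exp (suminf q)"
    using q by (simp add: sum_le_suminf)
  finally show ?thesis by (simp add: field_simps power_one_over)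
qed

lemma poisson_binomial_limit:
  fixes z :: complex
  assumes q: "\<And>i. 0 \<le> q i" "\<And>i. q i \<le> 1" "summable q"
    and e: "\<And>m. (\<lambda>k. poisson_binomial q k m) \<longlonglongrightarrow> e m"
    and z: "norm z \<le> 1"
  shows "convergent_prod (\<lambda>i. 1 + (z - 1) * of_real (q i))"
    and "(\<lambda>m. of_real (e m) * z ^ m) sums (\<Prod>i. 1 + (z - 1) * of_real (q i))"
proof -
  let ?F = "\<lambda>i. 1 + (z - 1) * of_real (q i)"
  have "summable (\<lambda>i. norm (?F i - 1))"
    using summable_mult[OF q(3), of "norm (z - 1)"] q(1) by (simp add: norm_mult)
  then show conv: "convergent_prod ?F"
    by (intro abs_convergent_prod_imp_convergent_prod summable_imp_abs_convergent_prod)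
  define a where "a m k = of_real (poisson_binomial q k m) * z ^ m" for m k
  have "norm (a m k) \<le> exp (suminf q) * (1 / 2) ^ m" for m k
  proof -
    have "norm (a m k) \<le> poisson_binomial q k m * 1"
      unfolding a_def norm_mult norm_power
      using poisson_binomial_nonneg[OF q(1,2), where k=k and m=m] z
      by (intro mult_mono) (auto intro: power_le_one)
    then show ?thesis using poisson_binomial_le[OF q, where k=k and m=m] by simp
  qed
  then have tannery: "eventually (\<lambda>k. summable (\<lambda>m. norm (a m k))) sequentially \<and>
     summable (\<lambda>m. norm (of_real (e m) * z ^ m)) \<and>
     (\<lambda>k. \<Sum>m. a m k) \<longlonglongrightarrow> (\<Sum>m. of_real (e m) * z ^ m)"
    by (intro tannerys_theorem[of _ _ _ "\<lambda>m. exp (suminf q) * (1 / 2) ^ m"])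
       (auto simp: a_def case_prod_unfold intro!: tendsto_intros e summable_mult summable_geometric)
  have "(\<lambda>k. \<Prod>i<k. ?F i) \<longlonglongrightarrow> prodinf ?F"
    using convergent_prod_LIMSEQ[OF conv] by (simp add: LIMSEQ_lessThan_iff_atMost)
  moreover have "(\<lambda>k. \<Sum>m. a m k) = (\<lambda>k. \<Prod>i<k. ?F i)"
    using poisson_binomial_sums[of q _ z] by (simp add: a_def sums_iff)
  ultimately have "(\<Sum>m. of_real (e m) * z ^ m) = prodinf ?F"
    using LIMSEQ_unique[OF tannery[THEN conjunct2, THEN conjunct2]] by simp
  moreover have "summable (\<lambda>m. of_real (e m) * z ^ m)"
    by (rule summable_norm_cancel[OF tannery[THEN conjunct2, THEN conjunct1]])
  ultimately show "(\<lambda>m. of_real (e m) * z ^ m) sums prodinf ?F"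
    by (simp add: sums_iff)
qed

section \<open>Counting primes whose exponent lies in a given set\<close>

definition omega_below :: "nat set \<Rightarrow> nat \<Rightarrow> nat \<Rightarrow> nat" where
  "omega_below J k n = card {p. prime p \<and> p < k \<and> multiplicity p n \<in> J}"

definition omega_in :: "nat set \<Rightarrow> nat \<Rightarrow> nat" where
  "omega_in J n = card {p. prime p \<and> multiplicity p n \<in> J}"

text \<open>
  Setting the probability to 0 at non-primes turns sums and products over primes into ones over all
  natural numbers.
\<close>

definition prime_valuation_density :: "nat set \<Rightarrow> nat \<Rightarrow> real" where
  "prime_valuation_density J p = (if prime p then valuation_density p J else 0)"

lemma omega_below_Suc:
  "omega_below J (Suc k) n = omega_below J k n + (if prime k \<and> multiplicity k n \<in> J then 1 else 0)"
proof -
  have "{p. prime p \<and> p < Suc k \<and> multiplicity p n \<in> J} =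
        {p. prime p \<and> p < k \<and> multiplicity p n \<in> J} \<union> (if prime k \<and> multiplicity k n \<in> J then {k} else {})"
    by (auto simp: less_Suc_eq)
  then show ?thesis by (simp add: omega_below_def)
qed

lemma omega_below_times_prime:
  assumes "prime k"
  shows "omega_below J k (k * n) = omega_below J k n"
proof -
  have "multiplicity p (k * n) = multiplicity p n" if "prime p" "p < k" for p
    using that assms by (intro multiplicity_prime_elem_times_other) (auto dest: primes_dvd_imp_eq)
  then show ?thesis unfolding omega_below_def by (metis (no_types, lifting))
qed

text \<open>
  When \<open>k\<close> is prime, the level sets of \<open>omega_below J k\<close> do not see \<open>k\<close>, so each of them splits into two
  independent parts according to the exponent of \<open>k\<close>.
\<close>

lemma has_natural_density_omega_below:
  "has_natural_density {n. n > 0 \<and> omega_below J k n = m} (poisson_binomial (prime_valuation_density J) k m)"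
proof (induction k arbitrary: m)
  case 0
  then show ?case
    using has_natural_density_positive has_natural_density_empty
    by (auto simp: omega_below_def)
next
  case (Suc k)
  let ?A = "\<lambda>m. {n. n > 0 \<and> omega_below J k n = m}"
  show ?case
  proof (cases "prime k")
    case True
    define d where "d = valuation_density k J"
    have d: "prime_valuation_density J k = d" using True by (simp add: prime_valuation_density_def d_def)
    have hit: "has_natural_density {n \<in> ?A l. multiplicity k n \<in> J} (d * poisson_binomial (prime_valuation_density J) k l)" for l
      unfolding d_def using True Suc.IH prime_gt_0_nat[OF True]
      by (intro has_natural_density_multiplicity) (auto simp: omega_below_times_prime)
    have miss: "has_natural_density (?A m - {n \<in> ?A m. multiplicity k n \<in> J})
                  (poisson_binomial (prime_valuation_density J) k m - d * poisson_binomial (prime_valuation_density J) k m)"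
      by (intro has_natural_density_Diff Suc.IH hit) auto
    show ?thesis
    proof (cases m)
      case 0
      have "?A m - {n \<in> ?A m. multiplicity k n \<in> J} = {n. n > 0 \<and> omega_below J (Suc k) n = m}"
        using True 0 by (auto simp: omega_below_Suc)
      then show ?thesis using miss 0 by (simp add: d algebra_simps)
    next
      case (Suc l)
      have "(?A m - {n \<in> ?A m. multiplicity k n \<in> J}) \<union> {n \<in> ?A l. multiplicity k n \<in> J} =
            {n. n > 0 \<and> omega_below J (Suc k) n = m}"
        using True Suc by (auto simp: omega_below_Suc split: if_splits)
      moreover have "has_natural_density ((?A m - {n \<in> ?A m. multiplicity k n \<in> J}) \<union> {n \<in> ?A l. multiplicity k n \<in> J})
         (poisson_binomial (prime_valuation_density J) k m - d * poisson_binomial (prime_valuation_density J) k m + d * poisson_binomial (prime_valuation_density J) k l)"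
        using Suc by (intro has_natural_density_disjoint_Un miss hit) auto
      ultimately show ?thesis using Suc by (simp add: d algebra_simps)
    qed
  next
    case False
    then show ?thesis using Suc.IH[of m] by (simp add: omega_below_Suc prime_valuation_density_def)
  qed
qed

lemma summable_inverse_squares: "summable (\<lambda>i. 1 / real i ^ 2)"
  using inverse_power_summable[of 2, where 'a = real] by (simp add: inverse_eq_divide)

text \<open>
  The union bound. For \<open>k = 0\<close> the term \<open>i = 0\<close> of the series is \<open>1 / 0 = 0\<close>, which is harmless because 0
  is not prime.
\<close>

lemma count_upto_prime_square_le:
  assumes "x > 0"
  shows "real (count_upto {n. \<exists>p\<ge>k. prime p \<and> p\<^sup>2 dvd n} x) \<le> x * (\<Sum>i. 1 / real (i + k) ^ 2)"
proof -
  define I where "I = {i. i < Suc (nat \<lfloor>x\<rfloor>) \<and> prime (i + k)}"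
  have "{n \<in> {n. \<exists>p\<ge>k. prime p \<and> p\<^sup>2 dvd n}. 0 < n \<and> real n \<le> x} \<subseteq>
        (\<Union>i\<in>I. {n \<in> (*) ((i + k)\<^sup>2) ` UNIV. 0 < n \<and> real n \<le> x})"
  proof
    fix n assume "n \<in> {n \<in> {n. \<exists>p\<ge>k. prime p \<and> p\<^sup>2 dvd n}. 0 < n \<and> real n \<le> x}"
    then obtain p where p: "p \<ge> k" "prime p" "p\<^sup>2 dvd n" and n: "0 < n" "real n \<le> x" by auto
    have "p \<le> p\<^sup>2" by (simp add: power2_eq_square)
    also have "\<dots> \<le> n" using p n by (intro dvd_imp_le)
    finally have "p - k < Suc (nat \<lfloor>x\<rfloor>)" using n by (simp add: less_Suc_eq_le le_nat_floor)
    then have "p - k \<in> I" using p by (simp add: I_def)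
    moreover have "n \<in> (*) ((p - k + k)\<^sup>2) ` UNIV" using p by (auto elim!: dvdE)
    ultimately show "n \<in> (\<Union>i\<in>I. {n \<in> (*) ((i + k)\<^sup>2) ` UNIV. 0 < n \<and> real n \<le> x})"
      using n by blast
  qed
  then have "count_upto {n. \<exists>p\<ge>k. prime p \<and> p\<^sup>2 dvd n} x \<le>
     card (\<Union>i\<in>I. {n \<in> (*) ((i + k)\<^sup>2) ` UNIV. 0 < n \<and> real n \<le> x})"
    unfolding count_upto_def by (intro card_mono) (auto simp: I_def)
  also have "\<dots> \<le> (\<Sum>i\<in>I. count_upto ((*) ((i + k)\<^sup>2) ` UNIV) x)"
    unfolding count_upto_def by (intro card_UN_le) (auto simp: I_def)
  also have "real \<dots> \<le> (\<Sum>i\<in>I. x * (1 / real (i + k) ^ 2))"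
    unfolding of_nat_sum
  proof (rule sum_mono)
    fix i assume "i \<in> I"
    then have "i + k > 0" using prime_gt_0_nat[of "i + k"] by (simp add: I_def)
    then show "real (count_upto ((*) ((i + k)\<^sup>2) ` UNIV) x) \<le> x * (1 / real (i + k) ^ 2)"
      using count_upto_le[of "x / real ((i + k)\<^sup>2)" UNIV] assms by (simp add: count_upto_times)
  qed
  also have "\<dots> = x * (\<Sum>i\<in>I. 1 / real (i + k) ^ 2)" by (simp add: sum_distrib_left)
  also have "\<dots> \<le> x * (\<Sum>i. 1 / real (i + k) ^ 2)"
  proof (intro mult_left_mono sum_le_suminf)
    show "summable (\<lambda>i. 1 / real (i + k) ^ 2)"
      using summable_inverse_squares by (rule summable_ignore_initial_segment)
  qed (use assms in \<open>auto simp: I_def\<close>)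
  finally show ?thesis by simp
qed

lemma omega_below_eq_omega_in:
  assumes "J \<subseteq> {2..}" "\<And>p. p \<ge> k \<Longrightarrow> prime p \<Longrightarrow> \<not> p\<^sup>2 dvd n"
  shows "omega_below J k n = omega_in J n"
proof -
  have "p < k" if "prime p" "multiplicity p n \<in> J" for p
    using that assms multiplicity_dvd'[of 2 p n] by (meson atLeast_iff not_less subsetD)
  then show ?thesis unfolding omega_below_def omega_in_def by metis
qed

section \<open>The generating functions\<close>

lemma omega_in_generating_function:
  fixes z :: complex
  assumes J: "J \<subseteq> {2..}" and z: "norm z \<le> 1"
  defines "e \<equiv> \<lambda>m. natural_density {n. n > 0 \<and> omega_in J n = m}"
    and "P \<equiv> prime_factor_seq (\<lambda>p. 1 + (z - 1) * of_real (valuation_density p J))"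
  shows "(\<forall>m. has_natural_density {n. n > 0 \<and> omega_in J n = m} (e m)) \<and>
         convergent_prod P \<and> (\<lambda>m. of_real (e m) * z ^ m) sums prodinf P"
proof -
  have tail: "(\<lambda>k. \<Sum>i. 1 / real (i + k) ^ 2) \<longlonglongrightarrow> 0"
    using suminf_exist_split2[OF summable_inverse_squares] .
  have dens: "has_natural_density {n. n > 0 \<and> omega_in J n = m} (e m) \<and>
              (\<lambda>k. poisson_binomial (prime_valuation_density J) k m) \<longlonglongrightarrow> e m" for m
  proof (rule has_natural_density_uniform_limit[OF has_natural_density_omega_below _ tail])
    fix k and x :: real assume x: "x > 0"
    have "\<bar>real (count_upto {n. n > 0 \<and> omega_below J k n = m} x) - real (count_upto {n. n > 0 \<and> omega_in J n = m} x)\<bar>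
          \<le> real (count_upto {n. \<exists>p\<ge>k. prime p \<and> p\<^sup>2 dvd n} x)"
      by (rule count_upto_diff_le) (use omega_below_eq_omega_in[OF J] in auto)
    also have "\<dots> \<le> x * (\<Sum>i. 1 / real (i + k) ^ 2)" by (rule count_upto_prime_square_le[OF x])
    finally show "\<bar>real (count_upto {n. n > 0 \<and> omega_below J k n = m} x) -
         real (count_upto {n. n > 0 \<and> omega_in J n = m} x)\<bar> \<le> x * (\<Sum>i. 1 / real (i + k) ^ 2)" .
  next
    fix d assume "(\<lambda>k. poisson_binomial (prime_valuation_density J) k m) \<longlonglongrightarrow> d"
      "has_natural_density {n. n > 0 \<and> omega_in J n = m} d"
    then show ?thesis unfolding e_def using natural_density_eqI by blast
  qed
  have nonneg: "prime_valuation_density J i \<ge> 0" and le: "prime_valuation_density J i \<le> 1 / real i ^ 2" for i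
    using valuation_density_nonneg valuation_density_le[OF _ J] prime_gt_1_nat
    by (auto simp: prime_valuation_density_def)
  have "1 / real i ^ 2 \<le> 1" for i by (cases "i = 0") auto
  then have le1: "prime_valuation_density J i \<le> 1" for i using le order_trans by blast
  have "summable (prime_valuation_density J)"
    by (rule summable_comparison_test[OF _ summable_inverse_squares]) (use nonneg le in auto)
  note poisson_binomial_limit[OF nonneg le1 this conjunct2[OF dens] z]
  moreover have "P = (\<lambda>i. 1 + (z - 1) * of_real (prime_valuation_density J i))"
    by (auto simp: P_def prime_factor_seq_def prime_valuation_density_def)
  ultimately show ?thesis using dens by simp
qed

lemma infsum_omega_eq_omega_in:
  assumes "n > 0" "0 \<notin> J"
  shows "(\<Sum>\<^sub>\<infinity>j\<in>J. omega j n) = omega_in J n"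
proof -
  let ?S = "{j. j \<in> J \<and> omega j n \<noteq> 0}" and ?T = "\<lambda>j. {p. prime p \<and> multiplicity p n = j}"
  have fin: "finite (?T j)" if "j \<in> J" for j
  proof (rule finite_subset)
    have "j \<noteq> 0" using that assms(2) by metis
    then show "?T j \<subseteq> prime_factors n" by (auto simp: prime_factors_multiplicity)
  qed simp
  have "(\<Sum>\<^sub>\<infinity>j\<in>J. omega j n) = (\<Sum>j\<in>?S. card (?T j))"
    unfolding infsum_omega[OF assms(1)] by (simp add: omega_def)
  also have "\<dots> = card (\<Union>j\<in>?S. ?T j)"
  proof (rule card_UN_disjoint[symmetric])
    show "finite ?S" by (rule finite_subset[OF _ finite_omega_support[OF assms(1)]]) auto
  qed (use fin assms in auto)
  also have "(\<Union>j\<in>?S. ?T j) = {p. prime p \<and> multiplicity p n \<in> J}"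
  proof -
    have "omega j n \<noteq> 0" if "j \<in> J" "prime p" "multiplicity p n = j" for j p
      using that fin[of j] assms(2) unfolding omega_def by (auto simp: card_eq_0_iff)
    then show ?thesis by auto
  qed
  finally show ?thesis by (simp add: omega_in_def)
qed

text \<open>
  The exponent sets of interest are arithmetic progressions, for which the local densities are
  geometric series.
\<close>

lemma omega_class_generating_function:
  fixes z :: complex
  assumes J: "J = range (\<lambda>i. a + b * i)" "a \<ge> 2" "b > 0" and z: "norm z \<le> 1"
    and f: "\<And>n. f n = (\<Sum>\<^sub>\<infinity>j\<in>J. omega j n)"
    and g: "\<And>p. prime p \<Longrightarrow> g p = 1 + (z - 1) * of_real ((1 - 1 / real p) / (real p ^ a * (1 - 1 / real p ^ b)))"
    and e: "\<And>m. e m = natural_density {n. n > 0 \<and> f n = m}"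
  shows "(\<forall>m. has_natural_density {n. n > 0 \<and> f n = m} (e m)) \<and>
         convergent_prod (prime_factor_seq g) \<and> (\<lambda>m. of_real (e m) * z ^ m) sums prodinf (prime_factor_seq g)"
proof -
  have J2: "J \<subseteq> {2..}" using J by auto
  then have "0 \<notin> J" by auto
  then have sets: "{n. n > 0 \<and> f n = m} = {n. n > 0 \<and> omega_in J n = m}" for m
    using infsum_omega_eq_omega_in by (auto simp: f)
  have "prime_factor_seq g = prime_factor_seq (\<lambda>p. 1 + (z - 1) * of_real (valuation_density p J))"
    unfolding prime_factor_seq_def J(1)
    by (auto simp: g valuation_density_progression[OF prime_gt_1_nat J(3)])
  then show ?thesis
    using omega_in_generating_function[OF J2 z] unfolding e sets by simp
qed

theorem corollary13:
  fixes z :: complex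
  assumes "norm z \<le> 1"
  defines "P_S \<equiv> prime_factor_seq (\<lambda>p. 1 + (z - 1) / of_nat p ^ 2)"
      and "P_E \<equiv> prime_factor_seq (\<lambda>p. 1 + (z - 1) / (of_nat p * (of_nat p + 1)))"
      and "P_O \<equiv> prime_factor_seq (\<lambda>p. 1 + (z - 1) / (of_nat p ^ 2 * (of_nat p + 1)))"
  shows "((\<forall>m. has_natural_density {n. n > 0 \<and> omega_S n = m} (e_S m)) \<and>
          convergent_prod P_S \<and>
          (\<lambda>m. of_real (e_S m) * z ^ m) sums prodinf P_S) \<and>
         ((\<forall>m. has_natural_density {n. n > 0 \<and> omega_E n = m} (e_E m)) \<and>
          convergent_prod P_E \<and>
          (\<lambda>m. of_real (e_E m) * z ^ m) sums prodinf P_E) \<and>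
         ((\<forall>m. has_natural_density {n. n > 0 \<and> omega_O n = m} (e_O m)) \<and>
          convergent_prod P_O \<and>
          (\<lambda>m. of_real (e_O m) * z ^ m) sums prodinf P_O)"
proof (intro conjI[of "_ \<and> _ \<and> _"])
  \<comment> \<open>Reduces each comparison of local factors to an identity without division by \<open>1 - 1/p\<close>.\<close>
  have local_factor: "1 + (z - 1) * of_real ((1 - 1 / real p) / (real p ^ a * (1 - 1 / real p ^ b))) = 1 + (z - 1) / of_nat N"
    if "prime p" "real N * (1 - 1 / real p) = real p ^ a * (1 - 1 / real p ^ b)" "N > 0" for p a b N
  proof -
    have "1 - 1 / real p \<noteq> 0" using prime_gt_1_nat[OF that(1)] by simp
    then have "(1 - 1 / real p) / (real p ^ a * (1 - 1 / real p ^ b)) = 1 / real N"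
      unfolding that(2)[symmetric] using that(3) by simp
    then show ?thesis by simp
  qed
  have p0: "real p \<noteq> 0" if "prime p" for p
    using prime_gt_0_nat[OF that] by simp
  have S: "{2..} = range (\<lambda>i. 2 + 1 * i :: nat)"
    by (auto simp: image_iff le_iff_add)
  show "(\<forall>m. has_natural_density {n. n > 0 \<and> omega_S n = m} (e_S m)) \<and>
          convergent_prod P_S \<and> (\<lambda>m. of_real (e_S m) * z ^ m) sums prodinf P_S"
    unfolding P_S_def
  proof (rule omega_class_generating_function[OF S _ _ assms(1) omega_S_def _ e_S_def])
    fix p :: nat assume p: "prime p"
    show "1 + (z - 1) / of_nat p ^ 2 = 1 + (z - 1) * of_real ((1 - 1 / real p) / (real p ^ 2 * (1 - 1 / real p ^ 1)))"
      using local_factor[OF p, of "p ^ 2" 2 1] prime_gt_0_nat[OF p] by simp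
  qed auto
  have E: "{j. j \<ge> 2 \<and> even j} = range (\<lambda>i. 2 + 2 * i :: nat)"
    by (auto simp: image_iff elim!: evenE) presburger
  show "(\<forall>m. has_natural_density {n. n > 0 \<and> omega_E n = m} (e_E m)) \<and>
          convergent_prod P_E \<and> (\<lambda>m. of_real (e_E m) * z ^ m) sums prodinf P_E"
    unfolding P_E_def
  proof (rule omega_class_generating_function[OF E _ _ assms(1) omega_E_def _ e_E_def])
    fix p :: nat assume p: "prime p"
    have "real (p * (p + 1)) * (1 - 1 / real p) = real p ^ 2 * (1 - 1 / real p ^ 2)"
      using p0[OF p] by (simp add: field_simps power2_eq_square)
    from local_factor[OF p this]
    show "1 + (z - 1) / (of_nat p * (of_nat p + 1)) =
          1 + (z - 1) * of_real ((1 - 1 / real p) / (real p ^ 2 * (1 - 1 / real p ^ 2)))"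
      using prime_gt_0_nat[OF p] by (simp add: distrib_left add_ac)
  qed auto
  have O: "{j. j \<ge> 3 \<and> odd j} = range (\<lambda>i. 3 + 2 * i :: nat)"
    by (auto simp: image_iff elim!: oddE) presburger
  show "(\<forall>m. has_natural_density {n. n > 0 \<and> omega_O n = m} (e_O m)) \<and>
          convergent_prod P_O \<and> (\<lambda>m. of_real (e_O m) * z ^ m) sums prodinf P_O"
    unfolding P_O_def
  proof (rule omega_class_generating_function[OF O _ _ assms(1) omega_O_def _ e_O_def])
    fix p :: nat assume p: "prime p"
    have "real (p ^ 2 * (p + 1)) * (1 - 1 / real p) = real p ^ 3 * (1 - 1 / real p ^ 2)"
      using p0[OF p] by (simp add: field_simps power2_eq_square power3_eq_cube)
    from local_factor[OF p this]
    show "1 + (z - 1) / (of_nat p ^ 2 * (of_nat p + 1)) =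
          1 + (z - 1) * of_real ((1 - 1 / real p) / (real p ^ 3 * (1 - 1 / real p ^ 2)))"
      using prime_gt_0_nat[OF p] by (simp add: distrib_left add_ac)
  qed auto
qed

end
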